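(* Let $n \ge 2$ be an integer, let $k \ge 0$ be an integer, and let $P_n$ be the path on $n$ vertices. Then $$\gamma_{\rm esp}(P_n)=\begin{cases} 2k & \text{if } n=4k,\\ 2k+1 & \text{if } n=4k+1,\\ 2k+2 & \text{if } n=4k+2 \text{ or } n=4k+3.\end{cases}$$
   Context: Graphs are finite, simple and undirected. For a graph $G=(V,E)$ and $S\subseteq V$, write $\overline{S}=V\setminus S$, and let $N(v)$ be the open neighbourhood of $v$. A set $S \subseteq V$ is an end super dominating set (ESD-set) of $G$ if for every $u\in\overline{S}$ there exists $v\in S$ with $N(v)\cap\overline{S}=\{u\}$, and moreover $\deg(u)\ge 2$ for every $u\in\overline{S}$. (Such a set is in particular a dominating set.) The end super domination number $\gamma_{\rm esp}(G)$ is the minimum cardinality of an ESD-set of $G$. *)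

theory Defs
  imports "Graph_Theory.Digraph"
begin

text \<open>
  As in the session Graph_Theory, a finite simple undirected graph is a symmetric digraph
  satisfying the locale \<^locale>\<open>graph\<close>: each edge is represented by its two
  opposite arcs.
\<close>

definition neighbourhood :: "('a, 'b) pre_digraph \<Rightarrow> 'a \<Rightarrow> 'a set" where
  "neighbourhood G v = {u. v \<rightarrow>\<^bsub>G\<^esub> u}"

text \<open>
  Each edge incident to \<open>u\<close> contributes exactly one arc with tail \<open>u\<close>, so the degree of
  \<open>u\<close> is its \<^const>\<open>out_degree\<close>.
\<close>

definition esd_set :: "('a, 'b) pre_digraph \<Rightarrow> 'a set \<Rightarrow> bool" where
  "esd_set G S \<longleftrightarrow> S \<subseteq> verts G \<and>
     (\<forall>u \<in> verts G - S.
        (\<exists>v \<in> S. neighbourhood G v \<inter> (verts G - S) = {u}) \<and> out_degree G u \<ge> 2)"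

definition esp_number :: "('a, 'b) pre_digraph \<Rightarrow> nat" where
  "esp_number G = Min {card S | S. esd_set G S}"

definition path_graph :: "nat \<Rightarrow> (nat, nat \<times> nat) pre_digraph" where
  "path_graph n =
     \<lparr> verts = {0..<n},
       arcs = {(i, j). i < n \<and> j < n \<and> (j = i + 1 \<or> i = j + 1)},
       tail = fst, head = snd \<rparr>"

lemma (in graph) out_degree_eq_card_neighbourhood:
  "out_degree G u = card (neighbourhood G u)"
proof -
  have "inj_on (head G) (out_arcs G u)"
    by (rule inj_onI) (auto simp: out_arcs_def arc_to_ends_def intro!: no_multi_arcs)
  moreover have "head G ` out_arcs G u = neighbourhood G u"
    by (auto simp: out_arcs_def neighbourhood_def arcs_ends_conv)
  ultimately show ?thesis
    by (metis out_degree_def card_image)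
qed

lemma (in fin_digraph) esp_number_well_defined:
  "finite {card S | S. esd_set G S}" "{card S | S. esd_set G S} \<noteq> {}"
proof -
  have "{card S | S. esd_set G S} \<subseteq> card ` Pow (verts G)"
    by (auto simp: esd_set_def)
  then show "finite {card S | S. esd_set G S}"
    by (rule finite_subset) simp
  have "esd_set G (verts G)"
    by (simp add: esd_set_def)
  then show "{card S | S. esd_set G S} \<noteq> {}"
    by blast
qed

lemma graph_path_graph: "graph (path_graph n)"
proof -
  have "finite {(i, j). i < n \<and> j < n \<and> (j = i + 1 \<or> i = j + 1)}"
    by (rule finite_subset[of _ "{0..<n} \<times> {0..<n}"]) auto
  then show ?thesis
    by unfold_locales
      (auto simp: path_graph_def arc_to_ends_def symmetric_def arcs_ends_conv intro!: symI)
qed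

end

theory Submission
  imports Defs
begin

text \<open>
  End vertices have degree one, so they lie in every ESD-set \<open>S\<close>. Among four consecutive vertices of
  the path at least two lie in \<open>S\<close>: three consecutive vertices outside \<open>S\<close> leave the middle one
  undominated, and in a pattern out-out-in-out the second vertex has only one neighbour in \<open>S\<close>,
  which sees two vertices outside. Cutting the path into blocks of four, after
  removing one or both ends when \<open>n\<close> is not divisible by four, gives the lower bound. It is attained
  by omitting the non-final vertices congruent to 1 or 2 modulo 4.
\<close>

lemma neighbourhood_path_graph:
  "neighbourhood (path_graph n) v = {u. u < n \<and> v < n \<and> (u = v + 1 \<or> v = u + 1)}"
  by (auto simp: neighbourhood_def path_graph_def arcs_ends_conv)

lemma verts_path_graph: "verts (path_graph n) = {..<n}"
  by (auto simp: path_graph_def)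

lemma out_degree_path_graph_ge_2_iff:
  assumes "u < n"
  shows "out_degree (path_graph n) u \<ge> 2 \<longleftrightarrow> 0 < u \<and> u + 1 < n"
proof -
  interpret graph "path_graph n" by (rule graph_path_graph)
  have "neighbourhood (path_graph n) u
      = (if 0 < u then {u - 1} else {}) \<union> (if u + 1 < n then {u + 1} else {})"
    using assms by (auto simp: neighbourhood_path_graph)
  then show ?thesis
    by (simp add: out_degree_eq_card_neighbourhood)
qed

text \<open>Only \<open>u - 1\<close> and \<open>u + 1\<close> can serve as \<open>v\<close>. Each
  has at most one further neighbour, two steps from \<open>u\<close>, and this one must lie in
  \<open>S\<close> unless it falls off the path; the guards \<open>2 \<le> u\<close> and
  \<open>u + 2 < n\<close> cover that exception.\<close>

lemma neighbourhood_path_graph_Int_eq_singleton_iff: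
  assumes "0 < u" "u + 1 < n" "u \<notin> S" "S \<subseteq> {..<n}"
  shows "(\<exists>v\<in>S. neighbourhood (path_graph n) v \<inter> ({..<n} - S) = {u}) \<longleftrightarrow>
    u - 1 \<in> S \<and> (2 \<le> u \<longrightarrow> u - 2 \<in> S) \<or> u + 1 \<in> S \<and> (u + 2 < n \<longrightarrow> u + 2 \<in> S)"
    (is "?L \<longleftrightarrow> ?R")
proof
  assume ?L
  then obtain v where v: "v \<in> S" "neighbourhood (path_graph n) v \<inter> ({..<n} - S) = {u}"
    by blast
  \<comment> \<open>To be applied to the vertex on the far side of \<open>v\<close> from
    \<open>u\<close>.\<close>
  have only: "w = u" if "w < n" "w = v + 1 \<or> v = w + 1" "w \<notin> S" for w
    using that v assms by (auto simp: neighbourhood_path_graph)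
  have "u = v + 1 \<or> v = u + 1"
    using v(2) by (auto simp: neighbourhood_path_graph)
  then show ?R
  proof
    assume "u = v + 1"
    then show ?R using v(1) assms only[of "u - 2"] by auto
  next
    assume "v = u + 1"
    then show ?R using v(1) assms only[of "u + 2"] by auto
  qed
next
  assume ?R
  then show ?L
  proof
    assume "u - 1 \<in> S \<and> (2 \<le> u \<longrightarrow> u - 2 \<in> S)"
    then have "neighbourhood (path_graph n) (u - 1) \<inter> ({..<n} - S) = {u}"
      using assms by (cases u) (auto simp: neighbourhood_path_graph)
    then show ?L using \<open>u - 1 \<in> S \<and> _\<close> by blast
  next
    assume "u + 1 \<in> S \<and> (u + 2 < n \<longrightarrow> u + 2 \<in> S)"
    then have "neighbourhood (path_graph n) (u + 1) \<inter> ({..<n} - S) = {u}"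
      using assms by (auto simp: neighbourhood_path_graph)
    then show ?L using \<open>u + 1 \<in> S \<and> _\<close> by blast
  qed
qed

text \<open>Reduces the ESD property to arithmetic on indices: the degree clause makes omitted
  vertices interior, and domination depends only on the vertices within distance two.\<close>

lemma esd_set_path_graph_iff:
  "esd_set (path_graph n) S \<longleftrightarrow> S \<subseteq> {..<n} \<and>
    (\<forall>u<n. u \<notin> S \<longrightarrow> 0 < u \<and> u + 1 < n \<and>
      (u - 1 \<in> S \<and> (2 \<le> u \<longrightarrow> u - 2 \<in> S) \<or> u + 1 \<in> S \<and> (u + 2 < n \<longrightarrow> u + 2 \<in> S)))"
proof -
  have "(\<exists>v\<in>S. neighbourhood (path_graph n) v \<inter> ({..<n} - S) = {u}) \<and>
      out_degree (path_graph n) u \<ge> 2 \<longleftrightarrow>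
    0 < u \<and> u + 1 < n \<and>
      (u - 1 \<in> S \<and> (2 \<le> u \<longrightarrow> u - 2 \<in> S) \<or> u + 1 \<in> S \<and> (u + 2 < n \<longrightarrow> u + 2 \<in> S))"
    if "S \<subseteq> {..<n}" "u < n" "u \<notin> S" for u
    using that out_degree_path_graph_ge_2_iff neighbourhood_path_graph_Int_eq_singleton_iff
    by blast
  then show ?thesis
    unfolding esd_set_def verts_path_graph by blast
qed

lemma esd_set_path_graph_window:
  assumes S: "esd_set (path_graph n) S" and a: "a + 4 \<le> n"
  shows "card (S \<inter> {a..<a + 4}) \<ge> 2"
proof -
  have dom: "u - 1 \<in> S \<and> (2 \<le> u \<longrightarrow> u - 2 \<in> S) \<or> u + 1 \<in> S \<and> (u + 2 < n \<longrightarrow> u + 2 \<in> S)"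
    if "u < n" "u \<notin> S" for u
    using S that by (auto simp: esd_set_path_graph_iff)
  have "{a..<a + 4} = {a, a + 1, a + 2, a + 3}"
    by auto
  \<comment> \<open>The four disjunctions say that each three of the four vertices include a member
    of \<open>S\<close>, so at most two are omitted. The last two are mirror images and use the
    vertex two steps away, which exists because \<open>a + 4 \<le> n\<close>.\<close>
  moreover have "a + 1 \<in> S \<or> a \<in> S \<or> a + 2 \<in> S"
    using dom[of "a + 1"] a by auto
  moreover have "a + 2 \<in> S \<or> a + 1 \<in> S \<or> a + 3 \<in> S"
    using dom[of "a + 2"] a by (auto simp: numeral_3_eq_3)
  moreover have "a \<in> S \<or> a + 1 \<in> S \<or> a + 3 \<in> S"
    using dom[of "a + 1"] a by (auto simp: numeral_3_eq_3)
  moreover have "a \<in> S \<or> a + 2 \<in> S \<or> a + 3 \<in> S"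
    using dom[of "a + 2"] a by (auto simp: numeral_3_eq_3)
  ultimately show ?thesis
    by (cases "a \<in> S"; cases "a + 1 \<in> S"; cases "a + 2 \<in> S"; cases "a + 3 \<in> S") simp_all
qed

text \<open>Adds up \<open>k\<close> disjoint windows. The start \<open>a\<close> is left free so
  that the blocks can also begin at 1, leaving vertex 0 to be counted separately.\<close>

lemma esd_set_path_graph_windows:
  assumes "esd_set (path_graph n) S" "a + 4 * k \<le> n"
  shows "card (S \<inter> {a..<a + 4 * k}) \<ge> 2 * k"
  using assms(2)
proof (induction k)
  case (Suc k)
  have "S \<inter> {a..<a + 4 * Suc k} = S \<inter> {a..<a + 4 * k} \<union> S \<inter> {a + 4 * k..<a + 4 * k + 4}"
    by auto
  moreover have "card \<dots> = card (S \<inter> {a..<a + 4 * k}) + card (S \<inter> {a + 4 * k..<a + 4 * k + 4})"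
    by (intro card_Un_disjoint) auto
  moreover have "card (S \<inter> {a + 4 * k..<a + 4 * k + 4}) \<ge> 2"
    using assms(1) Suc.prems by (intro esd_set_path_graph_window) auto
  ultimately show ?case
    using Suc by simp
qed simp

lemma esd_set_path_graph_card_ge:
  assumes S: "esd_set (path_graph n) S" and "n \<ge> 2"
  shows "n = 4 * k \<Longrightarrow> card S \<ge> 2 * k"
    and "n = 4 * k + 1 \<Longrightarrow> card S \<ge> 2 * k + 1"
    and "n = 4 * k + 2 \<or> n = 4 * k + 3 \<Longrightarrow> card S \<ge> 2 * k + 2"
proof -
  have out: "0 < u \<and> u + 1 < n" if "u < n" "u \<notin> S" for u
    using S that unfolding esd_set_path_graph_iff by blast
  have ends: "0 \<in> S" "n - 1 \<in> S"
    using out[of 0] out[of "n - 1"] \<open>n \<ge> 2\<close> by auto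
  have fin: "finite S"
    using S unfolding esd_set_path_graph_iff by (blast intro: finite_subset)
  \<comment> \<open>\<open>A\<close> will hold end vertices lying outside the blocks.\<close>
  have bound: "card (A \<union> S \<inter> {a..<a + 4 * k}) \<le> card S" if "A \<subseteq> S" for A a
    using fin that by (intro card_mono) auto
  show "card S \<ge> 2 * k" if "n = 4 * k"
    using bound[of "{}" 0] esd_set_path_graph_windows[OF S, of 0 k] that by simp
  show "card S \<ge> 2 * k + 1" if "n = 4 * k + 1"
    using bound[of "{0}" 1] esd_set_path_graph_windows[OF S, of 1 k] that ends by simp
  \<comment> \<open>The blocks fill 1 to \<open>4 * k\<close>, so both 0 and \<open>n - 1\<close>
    lie beyond them; for \<open>n = 4 * k + 3\<close> the vertex \<open>4 * k + 1\<close> simply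
    goes uncounted.\<close>
  show "card S \<ge> 2 * k + 2" if "n = 4 * k + 2 \<or> n = 4 * k + 3"
    using bound[of "{0, n - 1}" 1] esd_set_path_graph_windows[OF S, of 1 k] that ends
    by auto
qed

text \<open>The pattern in-out-out-in repeats, with the last vertex always kept. An omitted
  \<open>u\<close> is served by its left neighbour if it is 1 modulo 4 and by its right neighbour if
  it is 2 modulo 4; in each case the next vertex beyond, if any, is also kept.\<close>

lemma esd_set_path_graph_mod_4:
  "esd_set (path_graph n) {i. i < n \<and> (i + 1 = n \<or> i mod 4 = 0 \<or> i mod 4 = 3)}"
  (is "esd_set _ ?S")
  unfolding esd_set_path_graph_iff
proof (intro conjI allI impI)
  fix u
  assume u: "u < n" "u \<notin> ?S"
  then have m: "u + 1 \<noteq> n" "u mod 4 \<noteq> 0" "u mod 4 \<noteq> 3"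
    by auto
  then show "0 < u" "u + 1 < n"
    using u(1) by (auto intro: gr0I)
  show "u - 1 \<in> ?S \<and> (2 \<le> u \<longrightarrow> u - 2 \<in> ?S) \<or> u + 1 \<in> ?S \<and> (u + 2 < n \<longrightarrow> u + 2 \<in> ?S)"
  proof (cases "u mod 4 = 1")
    case True
    have "u = 4 * (u div 4) + 1"
      using True mult_div_mod_eq[of 4 u] by simp
    then obtain q where q: "u = 4 * q + 1" ..
    \<comment> \<open>For \<open>q = 0\<close> the vertex is 1, with nothing two steps to its left;
      otherwise \<open>u - 2\<close> ends the preceding block.\<close>
    have "u - 2 \<in> ?S" if "2 \<le> u"
    proof (cases q)
      case 0
      then show ?thesis using that q by simp
    next
      case (Suc r)
      then have "u - 2 = 4 * r + 3" using q by simp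
      then have "(u - 2) mod 4 = 3" by simp
      then show ?thesis using u(1) by simp
    qed
    moreover have "u - 1 \<in> ?S"
      using q u(1) by simp
    ultimately show ?thesis by blast
  next
    case False
    have "u mod 4 = 2"
      using m False mod_less_divisor[of 4 u] by linarith
    then have "u = 4 * (u div 4) + 2"
      using mult_div_mod_eq[of 4 u] by simp
    then obtain q where q: "u = 4 * q + 2" ..
    have "u + 1 = 4 * q + 3" "u + 2 = 4 * (q + 1)"
      using q by simp_all
    then have "(u + 1) mod 4 = 3" "(u + 2) mod 4 = 0"
      by (simp_all only: mod_mult_self1_is_0 mod_mult_self4) simp_all
    then show ?thesis using u(1) m(1) by force
  qed
qed auto

lemma card_mod_4_eq_0_or_3: "card {i. i < 4 * k \<and> (i mod 4 = 0 \<or> i mod 4 = (3::nat))} = 2 * k"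
proof (induction k)
  case (Suc k)
  have "{i. i < 4 * Suc k \<and> (i mod 4 = 0 \<or> i mod 4 = (3::nat))}
      = insert (4 * k) (insert (4 * k + 3) {i. i < 4 * k \<and> (i mod 4 = 0 \<or> i mod 4 = 3)})"
    by (rule set_eqI) (simp, presburger)
  then show ?case
    using Suc by simp
qed simp

text \<open>The full blocks contribute \<open>2 * k\<close>. In an incomplete last block
  \<open>4 * k\<close> is kept by its residue, and the clause \<open>i + 1 = n\<close> adds a
  further vertex exactly when \<open>n\<close> is 2 or 3 modulo 4.\<close>

lemma card_esd_set_path_graph_mod_4:
  fixes n k :: nat
  defines "S \<equiv> {i. i < n \<and> (i + 1 = n \<or> i mod 4 = 0 \<or> i mod 4 = 3)}"
  shows "n = 4 * k \<Longrightarrow> card S = 2 * k"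
    and "n = 4 * k + 1 \<Longrightarrow> card S = 2 * k + 1"
    and "n = 4 * k + 2 \<or> n = 4 * k + 3 \<Longrightarrow> card S = 2 * k + 2"
proof -
  let ?B = "{i. i < 4 * k \<and> (i mod 4 = 0 \<or> i mod 4 = 3)}"
  show "card S = 2 * k" if "n = 4 * k"
  proof -
    have "S = ?B"
      unfolding S_def that by (rule set_eqI) (simp, presburger)
    then show ?thesis by (simp add: card_mod_4_eq_0_or_3)
  qed
  show "card S = 2 * k + 1" if "n = 4 * k + 1"
  proof -
    have "S = insert (4 * k) ?B"
      unfolding S_def that by (rule set_eqI) (simp, presburger)
    then show ?thesis by (simp add: card_mod_4_eq_0_or_3)
  qed
  show "card S = 2 * k + 2" if "n = 4 * k + 2 \<or> n = 4 * k + 3"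
    using that
  proof
    assume n: "n = 4 * k + 2"
    have "S = insert (4 * k) (insert (4 * k + 1) ?B)"
      unfolding S_def n by (rule set_eqI) (simp, presburger)
    then show ?thesis by (simp add: card_mod_4_eq_0_or_3)
  next
    assume n: "n = 4 * k + 3"
    have "S = insert (4 * k) (insert (4 * k + 2) ?B)"
      unfolding S_def n by (rule set_eqI) (simp, presburger)
    then show ?thesis by (simp add: card_mod_4_eq_0_or_3)
  qed
qed

lemma esp_number_path_graph_eqI:
  assumes "esd_set (path_graph n) S" "card S = m"
    and "\<And>S'. esd_set (path_graph n) S' \<Longrightarrow> m \<le> card S'"
  shows "esp_number (path_graph n) = m"
proof -
  interpret graph "path_graph n" by (rule graph_path_graph)
  show ?thesis
    unfolding esp_number_def using assms
    by (intro Min_eqI esp_number_well_defined(1)) auto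
qed

theorem theorem3p5:
  fixes n k :: nat
  assumes "n \<ge> 2"
  shows "(n = 4 * k \<longrightarrow> esp_number (path_graph n) = 2 * k) \<and>
         (n = 4 * k + 1 \<longrightarrow> esp_number (path_graph n) = 2 * k + 1) \<and>
         (n = 4 * k + 2 \<or> n = 4 * k + 3 \<longrightarrow> esp_number (path_graph n) = 2 * k + 2)"
  by (intro conjI impI esp_number_path_graph_eqI[OF esd_set_path_graph_mod_4]
      card_esd_set_path_graph_mod_4 esd_set_path_graph_card_ge[OF _ assms])

end
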